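(* Let $s\ge 2$ be an integer and let $\mathcal H_s$ be the family of graphs with chromatic number greater than $s$. Then for every integer $k\ge 1$, \[ \frac1e\cdot s^k\ \le\ R_\ell(\mathcal H_s,k)\ \le\ s^k+1. \]
   Context: $K_n$ is the complete graph on $n$ vertices. For a list assignment $L:E(K_n)\to\binom{\mathbb N}{k}$ (each edge receives a set of $k$ colors), an $L$-coloring is an edge-coloring in which each edge $e$ receives a color from $L(e)$. For a family $\mathcal H$ of graphs, $R_\ell(\mathcal H,k)$ is the minimum $n$ such that there exists $L:E(K_n)\to\binom{\mathbb N}{k}$ for which every $L$-coloring of $K_n$ contains a monochromatic copy of some $H\in\mathcal H$. *)

theory Defs
  imports Complex_Main "HOL-Library.Extended_Real"
begin

text \<open>A graph is a pair of a vertex set and a set of edges, an edge being a two-element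
  set of vertices. All graphs are finite and simple.\<close>

type_synonym 'a sgraph = "'a set \<times> 'a set set"

definition verts :: "'a sgraph \<Rightarrow> 'a set" where
  "verts G = fst G"

definition edges :: "'a sgraph \<Rightarrow> 'a set set" where
  "edges G = snd G"

definition is_graph :: "'a sgraph \<Rightarrow> bool" where
  "is_graph G \<longleftrightarrow> finite (verts G) \<and> (\<forall>e\<in>edges G. e \<subseteq> verts G \<and> card e = 2)"

definition proper_vertex_coloring :: "'a sgraph \<Rightarrow> nat \<Rightarrow> ('a \<Rightarrow> nat) \<Rightarrow> bool" where
  "proper_vertex_coloring G m f \<longleftrightarrow>
     (\<forall>v\<in>verts G. f v < m) \<and> (\<forall>u v. {u, v} \<in> edges G \<longrightarrow> f u \<noteq> f v)"

definition chromatic_number :: "'a sgraph \<Rightarrow> nat" where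
  "chromatic_number G = (LEAST m. \<exists>f. proper_vertex_coloring G m f)"

text \<open>Copies are subgraphs, not necessarily induced ones.\<close>

definition contains_copy :: "'a sgraph \<Rightarrow> 'b sgraph \<Rightarrow> bool" where
  "contains_copy G H \<longleftrightarrow>
     (\<exists>\<phi>. inj_on \<phi> (verts H) \<and> \<phi> ` verts H \<subseteq> verts G \<and> (\<forall>e\<in>edges H. \<phi> ` e \<in> edges G))"

definition complete_graph :: "nat \<Rightarrow> nat sgraph" where
  "complete_graph n = ({..<n}, {e. e \<subseteq> {..<n} \<and> card e = 2})"

definition list_assignment :: "'a sgraph \<Rightarrow> nat \<Rightarrow> ('a set \<Rightarrow> nat set) \<Rightarrow> bool" where
  "list_assignment G k L \<longleftrightarrow> (\<forall>e\<in>edges G. finite (L e) \<and> card (L e) = k)"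

definition list_coloring :: "'a sgraph \<Rightarrow> ('a set \<Rightarrow> nat set) \<Rightarrow> ('a set \<Rightarrow> nat) \<Rightarrow> bool" where
  "list_coloring G L c \<longleftrightarrow> (\<forall>e\<in>edges G. c e \<in> L e)"

definition color_class :: "'a sgraph \<Rightarrow> ('a set \<Rightarrow> nat) \<Rightarrow> nat \<Rightarrow> 'a sgraph" where
  "color_class G c i = (verts G, {e \<in> edges G. c e = i})"

definition has_monochromatic_copy :: "'a sgraph \<Rightarrow> ('a set \<Rightarrow> nat) \<Rightarrow> 'b sgraph \<Rightarrow> bool" where
  "has_monochromatic_copy G c H \<longleftrightarrow> (\<exists>i. contains_copy (color_class G c i) H)"

text \<open>The minimum is taken in the extended naturals, so that it is \<open>\<infinity>\<close> if no suitable
  \<open>n\<close> exists; a finite upper bound thus includes the existence of such an \<open>n\<close>.\<close>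

definition list_ramsey_number :: "'b sgraph set \<Rightarrow> nat \<Rightarrow> enat" where
  "list_ramsey_number \<H> k =
     Inf {enat n | n. \<exists>L. list_assignment (complete_graph n) k L \<and>
       (\<forall>c. list_coloring (complete_graph n) L c \<longrightarrow>
          (\<exists>H\<in>\<H>. has_monochromatic_copy (complete_graph n) c H))}"

text \<open>Up to isomorphism every finite graph has its vertices in \<^typ>\<open>nat\<close>.\<close>

definition chromatic_family :: "nat \<Rightarrow> nat sgraph set" where
  "chromatic_family s = {H. is_graph H \<and> chromatic_number H > s}"

end

theory Submission
  imports Defs "HOL-Library.FuncSet"
begin

text \<open>The list Ramsey number is exactly \<open>s ^ k + 1\<close>. If all lists are equal and every colour class
  is \<open>s\<close>-colourable, the product of the \<open>k\<close> vertex colourings properly colours the complete graph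
  with \<open>s ^ k\<close> colours, so there are at most \<open>s ^ k\<close> vertices. Conversely, for at most \<open>s ^ k\<close>
  vertices and arbitrary lists, process the vertices one at a time and give each of them a value
  \<open>f c v < s\<close> for every colour \<open>c\<close>. An earlier vertex \<open>u\<close> rules out the choices at \<open>v\<close> that agree with
  those at \<open>u\<close> on the whole list of \<open>uv\<close>; this is a proportion \<open>1 / s ^ k\<close> of all choices, and fewer
  than \<open>s ^ k\<close> vertices are earlier, so some choice survives. Colouring \<open>uv\<close> by an element \<open>c\<close> of its
  list with \<open>f c u \<noteq> f c v\<close> makes \<open>f c\<close> a proper \<open>s\<close>-colouring of colour class \<open>c\<close>.\<close>

lemma card_PiE_agreeing:
  fixes h :: "'a \<Rightarrow> nat"
  assumes "finite C" "A \<subseteq> C" "\<And>c. h c < s"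
  shows "card {g \<in> C \<rightarrow>\<^sub>E {..<s}. \<forall>c\<in>A. g c = h c} = s ^ (card C - card A)"
proof -
  have "{g \<in> C \<rightarrow>\<^sub>E {..<s}. \<forall>c\<in>A. g c = h c} = (\<Pi>\<^sub>E c\<in>C. if c \<in> A then {h c} else {..<s})"
    using assms by (fastforce simp: PiE_iff split: if_splits)
  then have "card {g \<in> C \<rightarrow>\<^sub>E {..<s}. \<forall>c\<in>A. g c = h c} = (\<Prod>c\<in>C. card (if c \<in> A then {h c} else {..<s}))"
    using assms(1) by (simp add: card_PiE)
  also have "\<dots> = (\<Prod>c\<in>C. if c \<in> A then 1 else s)"
    by (rule prod.cong) auto
  also have "\<dots> = s ^ card (C - A)"
    using assms(1) by (simp add: prod.If_cases Diff_eq)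
  finally show ?thesis
    using assms(1,2) by (simp add: card_Diff_subset finite_subset)
qed

text \<open>Union bound over functions on the union \<open>C\<close> of the lists: each
  \<open>j\<close> excludes \<open>s ^ (card C - k)\<close> of the \<open>s ^ card C\<close>
  functions, and there are fewer than \<open>s ^ k\<close> indices \<open>j\<close>.\<close>

lemma exists_disagreeing_on_lists:
  fixes h :: "'b \<Rightarrow> 'a \<Rightarrow> nat"
  assumes "finite J" "card J < s ^ k" "s > 0"
    and lists: "\<And>j. j \<in> J \<Longrightarrow> finite (A j) \<and> card (A j) = k"
    and h: "\<And>j c. h j c < s"
  obtains g where "\<And>c. g c < s" "\<And>j. j \<in> J \<Longrightarrow> \<exists>c\<in>A j. g c \<noteq> h j c"
\<comment> \<open>Only a nonempty \<open>J\<close> gives \<open>k \<le> card C\<close>, which keeps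
  the natural-number subtraction \<open>card C - k\<close> from truncating.\<close>
proof (cases "J = {}")
  case True
  with \<open>s > 0\<close> that[of "\<lambda>_. 0"] show ?thesis by simp
next
  case False
  define C where "C = (\<Union>j\<in>J. A j)"
  define bad where "bad j = {g \<in> C \<rightarrow>\<^sub>E {..<s}. \<forall>c\<in>A j. g c = h j c}" for j
  have finC: "finite C"
    using assms by (simp add: C_def)
  have sub: "A j \<subseteq> C" if "j \<in> J" for j
    using that by (auto simp: C_def)
  have le: "k \<le> card C"
    using False lists sub finC by (metis card_mono ex_in_conv)
  have "card (\<Union>j\<in>J. bad j) \<le> (\<Sum>j\<in>J. card (bad j))"
    using \<open>finite J\<close> by (rule card_UN_le)
  also have "\<dots> = (\<Sum>j\<in>J. s ^ (card C - k))"
    by (rule sum.cong) (use card_PiE_agreeing[OF finC sub h] lists in \<open>simp_all add: bad_def\<close>)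
  also have "\<dots> < s ^ k * s ^ (card C - k)"
    using assms(2,3) by simp
  also have "\<dots> = card (C \<rightarrow>\<^sub>E {..<s})"
    using le finC by (simp add: card_funcsetE flip: power_add)
  finally have "\<not> (C \<rightarrow>\<^sub>E {..<s}) \<subseteq> (\<Union>j\<in>J. bad j)"
    using card_mono[of "\<Union>j\<in>J. bad j" "C \<rightarrow>\<^sub>E {..<s}"] \<open>finite J\<close> finC
    by (force simp: bad_def finite_PiE)
  then obtain g where g: "g \<in> C \<rightarrow>\<^sub>E {..<s}" "\<And>j. j \<in> J \<Longrightarrow> g \<notin> bad j"
    by blast
  show ?thesis
  \<comment> \<open>Off \<open>C\<close> the extensional \<open>g\<close> is
    \<open>undefined\<close>; the default 0 gives the bound \<open>s\<close> for every colour, and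
    disagreements occur only inside \<open>C\<close>.\<close>
  proof (rule that[of "\<lambda>c. if c \<in> C then g c else 0"])
    show "(if c \<in> C then g c else 0) < s" for c
      using g(1) \<open>s > 0\<close> by (auto simp: PiE_iff)
    show "\<exists>c\<in>A j. (if c \<in> C then g c else 0) \<noteq> h j c" if j: "j \<in> J" for j
    proof -
      obtain c where "c \<in> A j" "g c \<noteq> h j c"
        using g(1) g(2)[OF j] by (auto simp: bad_def)
      with sub[OF j] show ?thesis
        by (intro bexI[of _ c]) auto
    qed
  qed
qed

lemma exists_separating_vertex_colorings:
  fixes A :: "nat \<Rightarrow> nat \<Rightarrow> 'a set"
  assumes "n \<le> s ^ k" "s > 0"
    and "\<And>u v. u < v \<Longrightarrow> v < n \<Longrightarrow> finite (A u v) \<and> card (A u v) = k"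
  shows "\<exists>f. (\<forall>c v. f c v < s) \<and> (\<forall>v<n. \<forall>u<v. \<exists>c\<in>A u v. f c u \<noteq> f c v)"
  using assms(1,3)
proof (induction n)
  case 0
  with \<open>s > 0\<close> show ?case by auto
next
  case (Suc n)
  then obtain f where f: "\<And>c v. f c v < s" "\<And>u v. u < v \<Longrightarrow> v < n \<Longrightarrow> \<exists>c\<in>A u v. f c u \<noteq> f c v"
    by force
  \<comment> \<open>The new vertex \<open>n\<close> has exactly \<open>n\<close> predecessors, and
    \<open>n < s ^ k\<close> because \<open>Suc n \<le> s ^ k\<close>.\<close>
  obtain g where g: "\<And>c. g c < s" "\<And>u. u \<in> {..<n} \<Longrightarrow> \<exists>c\<in>A u n. g c \<noteq> f c u"
    by (rule exists_disagreeing_on_lists[of "{..<n}" s k "\<lambda>u. A u n" "\<lambda>u c. f c u"])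
      (use Suc.prems f \<open>s > 0\<close> in auto)
  have "\<exists>c\<in>A u v. ((f c)(n := g c)) u \<noteq> ((f c)(n := g c)) v" if "v < Suc n" "u < v" for u v
  proof (cases "v = n")
    case True
    with that g(2)[of u] show ?thesis by (metis fun_upd_apply lessThan_iff nat_neq_iff)
  next
    case False
    with that f(2)[of u v] show ?thesis by auto
  qed
  then show ?case
    using f(1) g(1) by (intro exI[of _ "\<lambda>c. (f c)(n := g c)"]) auto
qed

lemma chromatic_number_le:
  "proper_vertex_coloring G m f \<Longrightarrow> chromatic_number G \<le> m"
  unfolding chromatic_number_def by (rule Least_le) blast

lemma proper_vertex_coloring_mono:
  "proper_vertex_coloring G m f \<Longrightarrow> m \<le> m' \<Longrightarrow> proper_vertex_coloring G m' f"
  by (fastforce simp: proper_vertex_coloring_def)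

lemma proper_vertex_coloring_pullback:
  assumes "proper_vertex_coloring G m f" "\<phi> ` verts H \<subseteq> verts G" "\<And>e. e \<in> edges H \<Longrightarrow> \<phi> ` e \<in> edges G"
  shows "proper_vertex_coloring H m (f \<circ> \<phi>)"
  unfolding proper_vertex_coloring_def
proof (intro conjI allI impI ballI)
  show "(f \<circ> \<phi>) v < m" if "v \<in> verts H" for v
    using assms(1,2) that by (auto simp: proper_vertex_coloring_def)
  show "(f \<circ> \<phi>) u \<noteq> (f \<circ> \<phi>) v" if "{u, v} \<in> edges H" for u v
    using assms(1) assms(3)[OF that] by (simp add: proper_vertex_coloring_def)
qed

text \<open>The \<open>LEAST\<close> in \<open>chromatic_number\<close> is attained: numbering the
  finitely many vertices injectively is a proper colouring, as edges of size 2 exclude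
  loops.\<close>

lemma exists_proper_vertex_coloring_chromatic_number:
  assumes "is_graph G"
  shows "\<exists>f. proper_vertex_coloring G (chromatic_number G) f"
proof -
  obtain f where f: "f ` verts G \<subseteq> {..<card (verts G)}" "inj_on f (verts G)"
    using assms by (metis atLeast0LessThan bij_betw_def
        ex_bij_betw_finite_nat is_graph_def order_refl)
  have "f u \<noteq> f v" if "{u, v} \<in> edges G" for u v
  proof -
    have "u \<in> verts G" "v \<in> verts G" "card {u, v} = 2"
      using assms that by (auto simp: is_graph_def)
    moreover from this have "u \<noteq> v"
      by auto
    ultimately show ?thesis
      using f(2) by (simp add: inj_on_eq_iff)
  qed
  then have "proper_vertex_coloring G (card (verts G)) f"
    using f(1) by (auto simp: proper_vertex_coloring_def)
  then have "\<exists>m f. proper_vertex_coloring G m f"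
    by blast
  then show ?thesis
    unfolding chromatic_number_def by (rule LeastI_ex)
qed

lemma is_graph_color_class_complete: "is_graph (color_class (complete_graph n) c i)"
  by (auto simp: is_graph_def color_class_def complete_graph_def verts_def edges_def)

lemma doubleton_in_edges_complete_graph:
  "{u, v} \<in> edges (complete_graph n) \<longleftrightarrow> u < n \<and> v < n \<and> u \<noteq> v"
  by (auto simp: complete_graph_def edges_def card_insert_if)

lemma list_coloring_avoiding_chromatic_family:
  assumes "n \<le> s ^ k" "s > 0" and L: "list_assignment (complete_graph n) k L"
  obtains c where "list_coloring (complete_graph n) L c"
    "\<And>H. H \<in> chromatic_family s \<Longrightarrow> \<not> has_monochromatic_copy (complete_graph n) c H"
proof -
  have "finite (L {u, v}) \<and> card (L {u, v}) = k" if "u < v" "v < n" for u v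
    using L that by (simp add: list_assignment_def doubleton_in_edges_complete_graph)
  then have "\<exists>f. (\<forall>c v. f c v < s) \<and> (\<forall>v<n. \<forall>u<v. \<exists>c\<in>L {u, v}. f c u \<noteq> f c v)"
    by (rule exists_separating_vertex_colorings[OF assms(1,2)])
  then obtain f where f: "\<And>c v. f c v < s"
      "\<And>u v. u < v \<Longrightarrow> v < n \<Longrightarrow> \<exists>c\<in>L {u, v}. f c u \<noteq> f c v"
    by (elim exE conjE) metis
  \<comment> \<open>Injectivity on \<open>e\<close> says that \<open>f i\<close> separates its ends
    without ordering them, so a colour can be chosen per edge.\<close>
  have "\<exists>i\<in>L e. inj_on (f i) e" if "e \<in> edges (complete_graph n)" for e
  proof -
    obtain u v where e: "e = {u, v}" "u < v"
    proof -
      have "card e = 2"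
        using \<open>e \<in> edges (complete_graph n)\<close> by (simp add: complete_graph_def edges_def)
      then obtain u v where "e = {u, v}" "u \<noteq> v"
        by (auto simp: card_2_iff)
      then show thesis
        using that[of u v] that[of v u] by (cases "u < v") (auto simp: insert_commute)
    qed
    with that have "v < n"
      by (simp add: doubleton_in_edges_complete_graph)
    with e f(2) show ?thesis
      by fastforce
  qed
  then obtain c where c: "\<And>e. e \<in> edges (complete_graph n) \<Longrightarrow> c e \<in> L e \<and> inj_on (f (c e)) e"
    by metis
  have proper: "proper_vertex_coloring (color_class (complete_graph n) c i) s (f i)" for i
    unfolding proper_vertex_coloring_def
  proof (intro conjI allI impI ballI)
    show "f i u \<noteq> f i v" if "{u, v} \<in> edges (color_class (complete_graph n) c i)" for u v
    proof -
      have e: "{u, v} \<in> edges (complete_graph n)" "c {u, v} = i"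
        using that by (simp_all add: color_class_def edges_def)
      with c[OF e(1)] show ?thesis
        by (auto simp: doubleton_in_edges_complete_graph)
    qed
  qed (rule f(1))
  show ?thesis
  proof (rule that)
    show "list_coloring (complete_graph n) L c"
      using c by (simp add: list_coloring_def)
    show "\<not> has_monochromatic_copy (complete_graph n) c H" if "H \<in> chromatic_family s" for H
    proof
      assume "has_monochromatic_copy (complete_graph n) c H"
      then obtain i \<phi> where copy: "\<phi> ` verts H \<subseteq> verts (color_class (complete_graph n) c i)"
        "\<forall>e\<in>edges H. \<phi> ` e \<in> edges (color_class (complete_graph n) c i)"
        unfolding has_monochromatic_copy_def contains_copy_def by (elim exE conjE)
      from chromatic_number_le[OF proper_vertex_coloring_pullback[OF proper copy(1) bspec[OF copy(2)]]]
      show False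
        using that by (simp add: chromatic_family_def)
    qed
  qed
qed

lemma constant_lists_force_chromatic_family:
  assumes "s ^ k < n" and c: "list_coloring (complete_graph n) (\<lambda>_. {..<k}) c"
  shows "\<exists>H\<in>chromatic_family s. has_monochromatic_copy (complete_graph n) c H"
proof (rule ccontr)
  assume none: "\<not> ?thesis"
  let ?G = "color_class (complete_graph n) c"
  \<comment> \<open>Each colour class is a copy of itself, so if no member of the family occurs,
    every class is \<open>s\<close>-colourable.\<close>
  have "has_monochromatic_copy (complete_graph n) c (?G i)" for i
    unfolding has_monochromatic_copy_def contains_copy_def
    by (rule exI[of _ i], rule exI[of _ id]) simp
  with none have "chromatic_number (?G i) \<le> s" for i
    using is_graph_color_class_complete unfolding chromatic_family_def
    by (metis (mono_tags, lifting) mem_Collect_eq not_le)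
  then have "\<exists>f. proper_vertex_coloring (?G i) s f" for i
    using exists_proper_vertex_coloring_chromatic_number[OF is_graph_color_class_complete]
      proper_vertex_coloring_mono by blast
  then obtain f where f: "\<And>i. proper_vertex_coloring (?G i) s (f i)"
    by metis
  \<comment> \<open>The product colouring; \<open>restrict\<close> places it in a function space of
    size \<open>s ^ k\<close>. Two vertices differ at the coordinate given by the colour of their
    edge.\<close>
  define F where "F v = restrict (\<lambda>i. f i v) {..<k}" for v
  have "inj_on F {..<n}"
  proof (rule inj_onI, rule ccontr)
    fix u v
    assume uv: "u \<in> {..<n}" "v \<in> {..<n}" "F u = F v" "u \<noteq> v"
    then have e: "{u, v} \<in> edges (complete_graph n)"
      by (simp add: doubleton_in_edges_complete_graph)
    then have "c {u, v} < k" "f (c {u, v}) u \<noteq> f (c {u, v}) v"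
      using c f[of "c {u, v}"]
      by (auto simp: list_coloring_def proper_vertex_coloring_def color_class_def edges_def)
    with uv(3) show False
      unfolding F_def by (metis lessThan_iff restrict_apply')
  qed
  moreover have "F ` {..<n} \<subseteq> {..<k} \<rightarrow>\<^sub>E {..<s}"
    unfolding F_def using f
    by (intro image_subsetI restrict_PiE_iff[THEN iffD2] ballI)
      (simp add: proper_vertex_coloring_def color_class_def complete_graph_def verts_def)
  ultimately have "card {..<n} \<le> card ({..<k} \<rightarrow>\<^sub>E {..<s})"
    by (rule card_inj_on_le) (simp add: finite_PiE)
  with assms(1) show False
    by (simp add: card_funcsetE)
qed

theorem list_ramsey_number_chromatic_family:
  assumes "s > 0"
  shows "list_ramsey_number (chromatic_family s) k = enat (s ^ k + 1)"
  unfolding list_ramsey_number_def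
proof (rule antisym)
  let ?forces = "\<lambda>n L. list_assignment (complete_graph n) k L \<and>
    (\<forall>c. list_coloring (complete_graph n) L c \<longrightarrow>
      (\<exists>H\<in>chromatic_family s. has_monochromatic_copy (complete_graph n) c H))"
  have "?forces (s ^ k + 1) (\<lambda>_. {..<k})"
    using constant_lists_force_chromatic_family[of s k "s ^ k + 1"] by (simp add: list_assignment_def)
  then show "Inf {enat n |n. \<exists>L. ?forces n L} \<le> enat (s ^ k + 1)"
    by (intro Inf_lower) blast
  \<comment> \<open>By contraposition: for \<open>n \<le> s ^ k\<close> every \<open>L\<close>
    admits an avoiding colouring.\<close>
  have "s ^ k + 1 \<le> n" if "?forces n L" for n L
    using list_coloring_avoiding_chromatic_family[of n s k L] that assms
    by (metis Suc_eq_plus1 not_less_eq_eq)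
  then show "enat (s ^ k + 1) \<le> Inf {enat n |n. \<exists>L. ?forces n L}"
    by (intro Inf_greatest) auto
qed

theorem theorem8:
  fixes s k :: nat
  assumes "s \<ge> 2" and "k \<ge> 1"
  shows "ereal (1 / exp 1 * real s ^ k) \<le> ereal_of_enat (list_ramsey_number (chromatic_family s) k) \<and>
         list_ramsey_number (chromatic_family s) k \<le> enat (s ^ k + 1)"
proof -
  \<comment> \<open>The factor 1/e is at most 1, so the lower bound follows from the exact value
    \<open>s ^ k + 1\<close>.\<close>
  have "1 / exp 1 * real s ^ k \<le> 1 * real s ^ k"
    by (intro mult_right_mono) simp_all
  also have "\<dots> \<le> real (s ^ k + 1)"
    by simp
  finally show ?thesis
    using assms(1) by (simp add: list_ramsey_number_chromatic_family)
qed

end
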